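(* Let $d\in\mathbb N$, $a\in\mathbb N_0$, and let $PrEu(d,a;n,x):=\sum_{m=0}^n rEu(d,a;n,m)\,x^m$ for $n\in\mathbb N_0$. Then, as formal power series in $t$ and $x$, $$\sum_{n=0}^{\infty}PrEu(d,a;n,x)\,\frac{t^n}{n!}=\frac{(1-x)\,e^{a(1-x)t}}{1-x\,e^{d(1-x)t}}.$$
   Context: $\mathbb N=\{1,2,\dots\}$, $\mathbb N_0=\{0,1,2,\dots\}$. The generalized Stirling numbers of the second kind $S2(d,a;n,m)$, $0\le m\le n$, are defined by the operator identity $(a\,\mathbf 1+d\,\mathbf E_x)^n=\sum_{m=0}^n S2(d,a;n,m)\,x^m\,\mathbf d_x^{\,m}$, where $\mathbf d_x$ is differentiation with respect to $x$, $\mathbf E_x:=x\,\mathbf d_x$ and $\mathbf 1$ is the identity operator. The generalized (row reversed) Eulerian numbers are defined, for $0\le k\le n$, by $rEu(d,a;n,k):=\sum_{j=0}^k(-1)^{k-j}\binom{n-j}{k-j}S2(d,a;n,j)\,j!$. *)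

theory Defs
  imports "HOL-Computational_Algebra.Computational_Algebra"
begin

text \<open>The operator \<open>a \<one> + d E\<^sub>x\<close> with \<open>E\<^sub>x = x d\<^sub>x\<close>, acting on polynomials in \<open>x\<close>.\<close>

definition euler_op :: "'a::field_char_0 poly \<Rightarrow> 'a poly" where
  "euler_op p = [:0, 1:] * pderiv p"

definition gen_euler_op :: "nat \<Rightarrow> nat \<Rightarrow> rat poly \<Rightarrow> rat poly" where
  "gen_euler_op d a p = smult (of_nat a) p + smult (of_nat d) (euler_op p)"

definition is_normal_ordering :: "nat \<Rightarrow> nat \<Rightarrow> nat \<Rightarrow> (nat \<Rightarrow> rat) \<Rightarrow> bool" where
  "is_normal_ordering d a n c \<longleftrightarrow>
     (\<forall>p. (gen_euler_op d a ^^ n) p = (\<Sum>m\<le>n. smult (c m) (monom 1 m * (pderiv ^^ m) p)))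
     \<and> (\<forall>m>n. c m = 0)"

text \<open>The operator identity only concerns \<open>m \<le> n\<close>; setting the remaining values to \<open>0\<close> makes
  the coefficient function unique (see \<open>normal_ordering_unique_ex\<close> below).\<close>

definition S2 :: "nat \<Rightarrow> nat \<Rightarrow> nat \<Rightarrow> nat \<Rightarrow> rat" where
  "S2 d a n = (THE c. is_normal_ordering d a n c)"

definition rEu :: "nat \<Rightarrow> nat \<Rightarrow> nat \<Rightarrow> nat \<Rightarrow> rat" where
  "rEu d a n k = (\<Sum>j\<le>k. (-1) ^ (k - j) * of_nat ((n - j) choose (k - j)) * S2 d a n j * fact j)"

definition PrEu :: "nat \<Rightarrow> nat \<Rightarrow> nat \<Rightarrow> rat poly" where
  "PrEu d a n = (\<Sum>m\<le>n. monom (rEu d a n m) m)"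

lemma pderiv_funpow_monom_self: "(pderiv ^^ k) (monom (1::rat) k) = [:fact k:]"
proof -
  have "(pderiv ^^ j) (monom (c::rat) (k + j)) = monom (c * pochhammer (of_nat k + 1) j) k" for j k c
  proof (induction j arbitrary: c)
    case 0
    then show ?case by simp
  next
    case (Suc j)
    have "(pderiv ^^ Suc j) (monom c (k + Suc j)) = (pderiv ^^ j) (monom (of_nat (Suc (k + j)) * c) (k + j))"
      by (simp add: funpow_Suc_right pderiv_monom del: funpow.simps)
    also have "\<dots> = monom (of_nat (Suc (k + j)) * c * pochhammer (of_nat k + 1) j) k"
      by (rule Suc.IH)
    also have "\<dots> = monom (c * pochhammer (of_nat k + 1) (Suc j)) k"
      by (simp add: pochhammer_Suc algebra_simps)
    finally show ?case .
  qed
  from this[of k 1 0] show ?thesis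
    by (simp add: pochhammer_fact monom_0)
qed

lemma pderiv_funpow_monom_greater:
  assumes "k < m" shows "(pderiv ^^ m) (monom (1::rat) k) = 0"
proof -
  obtain i where m: "m = Suc i + k" using assms less_iff_Suc_add by (metis add.commute add_Suc)
  have z: "(pderiv ^^ i) (0 :: rat poly) = 0" for i by (induction i) auto
  have "(pderiv ^^ m) (monom (1::rat) k) = (pderiv ^^ i) (pderiv ((pderiv ^^ k) (monom 1 k)))"
    unfolding m funpow_add by (simp add: funpow_swap1)
  then show ?thesis by (simp add: pderiv_funpow_monom_self pderiv_pCons z)
qed

lemma normal_ordering_ex: "\<exists>c. is_normal_ordering d a n c"
proof (induction n)
  case 0
  show ?case
    by (rule exI[of _ "\<lambda>m. if m = 0 then 1 else 0"]) (simp add: is_normal_ordering_def)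
next
  case (Suc n)
  then obtain c where c: "\<And>p. (gen_euler_op d a ^^ n) p
      = (\<Sum>m\<le>n. smult (c m) (monom 1 m * (pderiv ^^ m) p))" and c0: "\<And>m. m > n \<Longrightarrow> c m = 0"
    unfolding is_normal_ordering_def by blast
  define c' where "c' m = (of_nat a + of_nat d * of_nat m) * c m
      + (if m = 0 then 0 else of_nat d * c (m - 1))" for m
  have add: "gen_euler_op d a (p + q) = gen_euler_op d a p + gen_euler_op d a q" for p q
    by (simp add: gen_euler_op_def euler_op_def pderiv_add smult_add_right algebra_simps)
  have zero: "gen_euler_op d a 0 = 0"
    by (simp add: gen_euler_op_def euler_op_def)
  have sum: "gen_euler_op d a (sum f A) = (\<Sum>x\<in>A. gen_euler_op d a (f x))" for f and A :: "nat set"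
    by (induction A rule: infinite_finite_induct) (simp_all add: add zero)
  have step: "gen_euler_op d a (smult u (monom 1 m * (pderiv ^^ m) p))
      = smult ((of_nat a + of_nat d * of_nat m) * u) (monom 1 m * (pderiv ^^ m) p)
      + smult (of_nat d * u) (monom 1 (Suc m) * (pderiv ^^ Suc m) p)" for u m p
  proof -
    have x: "[:0, 1:] * pderiv (monom 1 m) = (smult (of_nat m) (monom 1 m) :: rat poly)"
      by (cases m) (simp add: monom_0 pderiv_pCons,
          simp only: pderiv_monom, simp add: smult_monom monom_Suc)
    have "[:0, 1:] * pderiv (monom 1 m * (pderiv ^^ m) p)
        = ([:0, 1:] * pderiv (monom 1 m)) * (pderiv ^^ m) p
          + ([:0, 1:] * monom 1 m) * pderiv ((pderiv ^^ m) p)"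
      by (simp only: pderiv_mult) (simp only: algebra_simps)
    also have "[:0, 1:] * monom (1::rat) m = monom 1 (Suc m)"
      by (simp add: monom_Suc)
    finally show ?thesis unfolding gen_euler_op_def euler_op_def x
      by (simp add: pderiv_smult smult_add_left smult_add_right distrib_left mult_ac)
  qed
  have "is_normal_ordering d a (Suc n) c'"
    unfolding is_normal_ordering_def
  proof (intro conjI allI impI)
    fix p :: "rat poly"
    define f :: "nat \<Rightarrow> rat poly" where "f m = monom 1 m * (pderiv ^^ m) p" for m
    have "(gen_euler_op d a ^^ Suc n) p
        = (\<Sum>m\<le>n. smult ((of_nat a + of_nat d * of_nat m) * c m) (f m))
        + (\<Sum>m\<le>n. smult (of_nat d * c m) (f (Suc m)))"
      unfolding f_def by (simp only: funpow.simps o_apply c sum step sum.distrib)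
    also have "(\<Sum>m\<le>n. smult ((of_nat a + of_nat d * of_nat m) * c m) (f m))
        = (\<Sum>m\<le>Suc n. smult ((of_nat a + of_nat d * of_nat m) * c m) (f m))"
      by (simp add: c0)
    also have "(\<Sum>m\<le>n. smult (of_nat d * c m) (f (Suc m)))
        = (\<Sum>m\<le>Suc n. smult (if m = 0 then 0 else of_nat d * c (m - 1)) (f m))"
      by (subst sum.atMost_Suc_shift) simp
    finally show "(gen_euler_op d a ^^ Suc n) p = (\<Sum>m\<le>Suc n. smult (c' m) (monom 1 m * (pderiv ^^ m) p))"
      unfolding c'_def by (simp only: smult_add_left sum.distrib f_def)
  next
    fix m assume "Suc n < m"
    then show "c' m = 0" by (simp add: c'_def c0)
  qed
  then show ?case by blast
qed

lemma normal_ordering_unique: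
  assumes "is_normal_ordering d a n c" and "is_normal_ordering d a n c'"
  shows "c = c'"
proof
  have eq: "(\<Sum>m\<le>n. smult (c m) (monom 1 m * (pderiv ^^ m) p))
      = (\<Sum>m\<le>n. smult (c' m) (monom 1 m * (pderiv ^^ m) p))" for p
    using assms unfolding is_normal_ordering_def by metis
  fix k
  show "c k = c' k"
  proof (induction k rule: less_induct)
    case (less k)
    show ?case
    proof (cases "k \<le> n")
      case False
      then show ?thesis using assms by (simp add: is_normal_ordering_def)
    next
      case True
      let ?f = "\<lambda>m. monom 1 m * (pderiv ^^ m) (monom (1::rat) k)"
      have "(\<Sum>m\<le>n. smult (c m - c' m) (?f m)) = 0"
        using eq[of "monom 1 k"] by (simp add: smult_diff_left sum_subtractf)
      also have "(\<Sum>m\<le>n. smult (c m - c' m) (?f m)) = (\<Sum>m\<in>{k}. smult (c m - c' m) (?f m))"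
      proof (rule sum.mono_neutral_right)
        show "\<forall>m\<in>{..n} - {k}. smult (c m - c' m) (?f m) = 0"
        proof
          fix m assume "m \<in> {..n} - {k}"
          then consider "m < k" | "m > k" by fastforce
          then show "smult (c m - c' m) (?f m) = 0"
            by cases (simp_all add: less.IH pderiv_funpow_monom_greater)
        qed
      qed (use True in auto)
      finally show ?thesis
        by (simp add: pderiv_funpow_monom_self)
    qed
  qed
qed

lemma normal_ordering_unique_ex: "\<exists>!c. is_normal_ordering d a n c"
  using normal_ordering_ex normal_ordering_unique by blast

lemma is_normal_ordering_S2: "is_normal_ordering d a n (S2 d a n)"
  unfolding S2_def by (rule theI'[OF normal_ordering_unique_ex])

text \<open>The generating functions live in \<open>\<rat>[[x]][[t]]\<close>, i.e. \<^typ>\<open>rat fps fps\<close>: the outer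
  variable is \<open>t\<close>, the inner one is \<open>x\<close>. The exponential \<open>e\<^bsup>ct\<^esup>\<close> with \<open>c \<in> \<rat>[[x]]\<close> is
  \<^term>\<open>fps_exp c\<close>. The library division on \<^typ>\<open>rat fps fps\<close> is defined
  over the inner inverse, so it is the intended quotient only for a divisor whose constant
  coefficient in \<open>t\<close> is a unit of \<open>\<rat>[[x]]\<close>; for the divisor of the Eulerian generating
  function that coefficient is \<open>1 - x\<close>, and the next lemma confirms that division is genuine.\<close>

lemma fps_fps_divide_times_cancel:
  fixes f g :: "rat fps fps"
  assumes "(g $ 0) $ 0 \<noteq> 0"
  shows "f / g * g = f"
proof -
  have g0: "g $ 0 \<noteq> 0" using assms by auto
  have "g $ 0 * inverse (g $ 0) = 1"
    using assms by (metis inverse_mult_eq_1')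
  then have "g * inverse g = 1"
    by (simp add: fps_inverse_def fps_right_inverse)
  moreover have "f / g = f * inverse g"
    using g0 by (simp add: fps_divide_def subdegree_eq_0)
  ultimately show ?thesis by (simp add: mult_ac)
qed

end

theory Submission
  imports Defs
begin

text \<open>Applying the normal ordered \<open>n\<close>-th power of \<open>a \<one> + d E\<^sub>x\<close> to \<open>x\<^sup>k\<close> gives
  \<open>(a + d k)\<^sup>n = (\<Sum>m. S2(n,m) m! binom(k,m))\<close>. Summing over \<open>k\<close> against \<open>x\<^sup>k\<close> and clearing the
  denominator \<open>(1 - x)\<^sup>n\<^sup>+\<^sup>1\<close> turns the right-hand side into the Eulerian polynomial, i.e.
  \<open>PrEu\<^sub>n = (1 - x)\<^sup>n\<^sup>+\<^sup>1 F\<^sub>a\<^sub>,\<^sub>n\<close> with \<open>F\<^sub>a\<^sub>,\<^sub>n = (\<Sum>k. (a + d k)\<^sup>n x\<^sup>k)\<close>. Multiplying the generating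
  function by \<open>1 - x e\<^bsup>d(1-x)t\<^esup>\<close> then replaces \<open>F\<^sub>a\<^sub>,\<^sub>n\<close> by \<open>F\<^sub>a\<^sub>,\<^sub>n - x F\<^sub>a\<^sub>+\<^sub>d\<^sub>,\<^sub>n = a\<^sup>n\<close>.\<close>

lemma gen_euler_op_monom:
  "gen_euler_op d a (monom c k) = smult (of_nat a + of_nat d * of_nat k) (monom c k)"
  by (cases k)
    (simp_all add: gen_euler_op_def euler_op_def pderiv_monom smult_monom monom_0 pderiv_pCons
      algebra_simps add_monom flip: monom_Suc)

lemma gen_euler_op_funpow_monom:
  "(gen_euler_op d a ^^ n) (monom c k) = smult ((of_nat a + of_nat d * of_nat k) ^ n) (monom c k)"
  by (induction n) (simp_all add: smult_monom gen_euler_op_monom algebra_simps)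

text \<open>Evaluating at 1 removes the remaining power of x, so the case \<open>m > k\<close> needs
  no truncated exponent: both sides are then 0. The induction step is the absorption identity for
  binomial coefficients.\<close>

lemma poly_pderiv_funpow_monom_1:
  "poly ((pderiv ^^ m) (monom (1::rat) k)) 1 = fact m * of_nat (k choose m)"
proof (induction m arbitrary: k)
  case 0
  show ?case by (simp add: poly_monom)
next
  case (Suc m)
  have smult: "(pderiv ^^ m) (smult c p) = smult c ((pderiv ^^ m) p)" for c and p :: "rat poly"
    by (induction m) (simp_all add: pderiv_smult)
  show ?case
  proof (cases k)
    case 0
    have "(pderiv ^^ m) (0 :: rat poly) = 0" by (induction m) simp_all
    with 0 show ?thesis
      by (simp add: funpow_Suc_right pderiv_pCons monom_0 del: funpow.simps)
  next
    case (Suc j)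
    have "pderiv (monom (1::rat) k) = smult (of_nat k) (monom 1 j)"
      by (simp add: Suc pderiv_monom smult_monom)
    then have "poly ((pderiv ^^ Suc m) (monom (1::rat) k)) 1 = of_nat k * (fact m * of_nat (j choose m))"
      by (simp add: funpow_Suc_right smult Suc.IH del: funpow.simps)
    also have "\<dots> = fact m * of_nat (Suc j * (j choose m))"
      by (simp only: Suc of_nat_mult mult.left_commute)
    also have "Suc j * (j choose m) = Suc m * (k choose Suc m)"
      unfolding Suc by (metis Suc_times_binomial_eq mult.commute)
    finally show ?thesis by (simp add: algebra_simps)
  qed
qed

text \<open>Each monomial is an eigenvector of the operator, with eigenvalue a + d k. Comparing this
  with the normal ordered form at x = 1 leaves an identity of numbers.\<close>

lemma power_eq_sum_S2:
  "(of_nat a + of_nat d * of_nat k) ^ n = (\<Sum>m\<le>n. S2 d a n m * fact m * of_nat (k choose m))"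
proof -
  have "(gen_euler_op d a ^^ n) (monom 1 k)
      = (\<Sum>m\<le>n. smult (S2 d a n m) (monom 1 m * (pderiv ^^ m) (monom 1 k)))"
    using is_normal_ordering_S2[of d a n] unfolding is_normal_ordering_def by blast
  from arg_cong[OF this, of "\<lambda>p. poly p 1"] show ?thesis
    by (simp add: gen_euler_op_funpow_monom poly_monom poly_sum poly_pderiv_funpow_monom_1 mult.assoc)
qed

text \<open>Multiplication by 1 - x takes differences in k; by Pascal's rule this lowers
  \<open>Suc m\<close> to \<open>m\<close> at the cost of a factor x.\<close>

lemma fps_choose_times_one_minus_X_power:
  "Abs_fps (\<lambda>k. of_nat (k choose m)) * (1 - fps_X) ^ Suc m = (fps_X ^ m :: 'a::comm_ring_1 fps)"
proof (induction m)
  case 0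
  show ?case by (rule fps_ext) (simp add: algebra_simps)
next
  case (Suc m)
  have "Abs_fps (\<lambda>k. of_nat (k choose Suc m)) * (1 - fps_X)
      = fps_X * (Abs_fps (\<lambda>k. of_nat (k choose m)) :: 'a fps)"
  proof (rule fps_ext)
    fix k
    show "(Abs_fps (\<lambda>k. of_nat (k choose Suc m)) * (1 - fps_X)) $ k
        = (fps_X * (Abs_fps (\<lambda>k. of_nat (k choose m)) :: 'a fps)) $ k"
      by (cases k) (simp_all add: algebra_simps)
  qed
  then have "Abs_fps (\<lambda>k. of_nat (k choose Suc m)) * (1 - fps_X) ^ Suc (Suc m)
      = fps_X * Abs_fps (\<lambda>k. of_nat (k choose m)) * (1 - fps_X :: 'a fps) ^ Suc m"
    by (simp only: power_Suc[of _ "Suc m"] flip: mult.assoc)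
  then show ?case by (simp only: mult.assoc Suc.IH power_Suc[of fps_X])
qed

text \<open>The alternating binomials in \<open>rEu\<close> are the coefficients of (1 - x)^(n -
  j).\<close>

lemma fps_of_poly_PrEu_eq_sum_S2:
  "fps_of_poly (PrEu d a n)
    = (\<Sum>j\<le>n. fps_const (S2 d a n j * fact j) * fps_X ^ j * (1 - fps_X) ^ (n - j))"
proof -
  let ?u = "\<lambda>j i. fps_const (S2 d a n j * fact j) * fps_X ^ j
    * (of_nat ((n - j) choose i) * (- fps_X) ^ i)"
  have "fps_of_poly (PrEu d a n) = (\<Sum>m\<le>n. \<Sum>j\<le>m. ?u j (m - j))"
    unfolding PrEu_def fps_of_poly_sum
  proof (rule sum.cong)
    fix m assume "m \<in> {..n}"
    have "fps_of_poly (monom (rEu d a n m) m) = fps_const (rEu d a n m) * fps_X ^ m"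
      by (simp add: fps_of_poly_monom)
    also have "\<dots> = (\<Sum>j\<le>m. fps_const ((-1) ^ (m - j) * of_nat ((n - j) choose (m - j))
        * S2 d a n j * fact j) * fps_X ^ m)"
      unfolding rEu_def by (rule fps_ext) (simp add: fps_sum_nth sum_distrib_right)
    also have "\<dots> = (\<Sum>j\<le>m. ?u j (m - j))"
    proof (rule sum.cong)
      fix j assume "j \<in> {..m}"
      then have "fps_X ^ m = (fps_X ^ j * fps_X ^ (m - j) :: rat fps)"
        by (simp flip: power_add)
      moreover have "(- fps_X) ^ (m - j) = fps_const ((-1) ^ (m - j)) * (fps_X ^ (m - j) :: rat fps)"
        by (subst power_minus) (simp flip: fps_const_power fps_const_neg)
      ultimately show "fps_const ((-1) ^ (m - j) * of_nat ((n - j) choose (m - j))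
        * S2 d a n j * fact j) * fps_X ^ m = ?u j (m - j)"
        by (simp add: fps_of_nat[symmetric] mult_ac flip: fps_const_mult)
    qed simp
    finally show "fps_of_poly (monom (rEu d a n m) m) = (\<Sum>j\<le>m. ?u j (m - j))" .
  qed simp
  \<comment> \<open>With i = m - j the double sum runs over a triangle, so for fixed j the sum over
    i becomes a complete binomial expansion.\<close>
  also have "\<dots> = (\<Sum>(j, i) \<in> {(j, i). j + i \<le> n}. ?u j i)"
    by (rule sum.triangle_reindex_eq[symmetric])
  also have "{(j, i). j + i \<le> n} = Sigma {..n} (\<lambda>j. {..n - j})"
    by auto
  also have "(\<Sum>(j, i) \<in> Sigma {..n} (\<lambda>j. {..n - j}). ?u j i) = (\<Sum>j\<le>n. \<Sum>i\<le>n - j. ?u j i)"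
    by (rule sum.Sigma[symmetric]) auto
  also have "\<dots> = (\<Sum>j\<le>n. fps_const (S2 d a n j * fact j) * fps_X ^ j * (1 - fps_X) ^ (n - j))"
  proof (rule sum.cong)
    fix j
    show "(\<Sum>i\<le>n - j. ?u j i) = fps_const (S2 d a n j * fact j) * fps_X ^ j * (1 - fps_X) ^ (n - j)"
      using binomial_ring[of "- fps_X :: rat fps" 1 "n - j"]
      by (simp add: sum_distrib_left)
  qed simp
  finally show ?thesis .
qed

definition arith_power_fps :: "nat \<Rightarrow> nat \<Rightarrow> nat \<Rightarrow> rat fps" where
  "arith_power_fps d a n = Abs_fps (\<lambda>k. (of_nat a + of_nat d * of_nat k) ^ n)"

lemma fps_of_poly_PrEu:
  "fps_of_poly (PrEu d a n) = (1 - fps_X) ^ Suc n * arith_power_fps d a n"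
proof -
  let ?B = "\<lambda>m. Abs_fps (\<lambda>k. of_nat (k choose m)) :: rat fps"
  have "arith_power_fps d a n = (\<Sum>j\<le>n. fps_const (S2 d a n j * fact j) * ?B j)"
    by (rule fps_ext) (simp add: arith_power_fps_def power_eq_sum_S2 fps_sum_nth)
  then have "(1 - fps_X) ^ Suc n * arith_power_fps d a n
      = (\<Sum>j\<le>n. fps_const (S2 d a n j * fact j) * ((1 - fps_X) ^ Suc n * ?B j))"
    by (simp add: sum_distrib_left mult_ac)
  also have "\<dots> = (\<Sum>j\<le>n. fps_const (S2 d a n j * fact j) * fps_X ^ j * (1 - fps_X) ^ (n - j))"
  proof (rule sum.cong)
    fix j assume "j \<in> {..n}"
    then have "Suc n = Suc j + (n - j)" by simp
    then have "(1 - fps_X) ^ Suc n * ?B j = (?B j * (1 - fps_X) ^ Suc j) * (1 - fps_X) ^ (n - j)"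
      by (metis (no_types) power_add mult.commute mult.assoc)
    then show "fps_const (S2 d a n j * fact j) * ((1 - fps_X) ^ Suc n * ?B j)
        = fps_const (S2 d a n j * fact j) * fps_X ^ j * (1 - fps_X) ^ (n - j)"
      by (simp only: fps_choose_times_one_minus_X_power mult.assoc)
  qed simp
  finally show ?thesis by (simp only: fps_of_poly_PrEu_eq_sum_S2)
qed

text \<open>Since (a + d) + d (k - 1) = a + d k, the two series cancel except at k = 0.\<close>

lemma arith_power_fps_shift:
  "arith_power_fps d a n - fps_X * arith_power_fps d (a + d) n = of_nat (a ^ n)"
proof (rule fps_ext)
  fix k
  show "(arith_power_fps d a n - fps_X * arith_power_fps d (a + d) n) $ k = of_nat (a ^ n) $ k"
    by (cases k) (simp_all add: arith_power_fps_def fps_of_nat[symmetric] algebra_simps)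
qed

text \<open>The binomial theorem for (a + d k) + d, in the shape of the convolution produced by
  multiplying with an exponential series in t.\<close>

lemma arith_power_fps_add:
  "arith_power_fps d (a + d) n
    = (\<Sum>i\<le>n. of_nat (n choose i) * arith_power_fps d a i * of_nat d ^ (n - i))"
proof (rule fps_ext)
  fix k
  have coeff: "(of_nat (n choose i) * arith_power_fps d a i * of_nat d ^ (n - i)) $ k
      = of_nat (n choose i) * (of_nat a + of_nat d * of_nat k) ^ i * of_nat d ^ (n - i)" for i
  proof -
    have "of_nat (n choose i) * arith_power_fps d a i * of_nat d ^ (n - i)
        = fps_const (of_nat (n choose i)) * (arith_power_fps d a i * fps_const (of_nat d ^ (n - i)))"
      by (simp add: fps_of_nat mult.assoc flip: fps_const_power)
    then show ?thesis
      by (simp only: fps_mult_left_const_nth fps_mult_right_const_nth)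
        (simp add: arith_power_fps_def)
  qed
  have "of_nat (a + d) + of_nat d * of_nat k = (of_nat a + of_nat d * of_nat k) + (of_nat d :: rat)"
    by simp
  then have "arith_power_fps d (a + d) n $ k
      = ((of_nat a + of_nat d * of_nat k) + (of_nat d :: rat)) ^ n"
    by (simp only: arith_power_fps_def fps_nth_Abs_fps)
  then show "arith_power_fps d (a + d) n $ k
    = (\<Sum>i\<le>n. of_nat (n choose i) * arith_power_fps d a i * of_nat d ^ (n - i)) $ k"
    by (simp only: binomial_ring fps_sum_nth coeff)
qed

lemma fps_divide_fact: "f / fact n = f * fps_const (1 / fact n :: rat)"
proof -
  have "fact n = (fps_const (fact n) :: rat fps)"
    by (metis fps_of_nat of_nat_fact)
  then show ?thesis
    by (simp add: fps_divide_unit fps_const_inverse divide_inverse)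
qed

text \<open>Reduces the quotient to a product identity; cancelling \<open>g\<close> is sound because
  the double series form an integral domain.\<close>

lemma fps_fps_eq_divideI:
  fixes f g h :: "rat fps fps"
  assumes "(g $ 0) $ 0 \<noteq> 0" and "f * g = h"
  shows "f = h / g"
proof -
  have "h / g * g = f * g"
    using fps_fps_divide_times_cancel[OF assms(1)] assms(2) by simp
  moreover have "g \<noteq> 0"
    using assms(1) by auto
  ultimately show ?thesis
    by simp
qed

theorem mainTheorem12:
  fixes d a :: nat
  assumes "d \<ge> 1"
  shows "Abs_fps (\<lambda>n. fps_of_poly (PrEu d a n) / fact n) =
    (fps_const (1 - fps_X) * fps_exp (of_nat a * (1 - fps_X))) /
    (1 - fps_const fps_X * fps_exp (of_nat d * (1 - fps_X)) :: rat fps fps)"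
    (is "?G = ?f / ?g")
proof -
  let ?y = "1 - fps_X :: rat fps"
  let ?c = "\<lambda>n. fps_const (1 / fact n :: rat)"
  have e: "fps_exp c $ n = c ^ n * ?c n" for c :: "rat fps" and n
    by (simp only: fps_exp_nth of_nat_fact fps_divide_fact)
  have "?G * ?g = ?f"
  proof (rule fps_ext)
    fix n
    have P: "?G $ i = ?y ^ Suc i * arith_power_fps d a i * ?c i" for i
      by (simp only: fps_nth_Abs_fps fps_divide_fact fps_of_poly_PrEu)
    \<comment> \<open>The exponents of 1 - x add up to n + 1 whatever i is, so this power and 1/n!
      leave the convolution and \<open>arith_power_fps_add\<close> sums the rest.\<close>
    have conv: "?G $ i * fps_exp (of_nat d * ?y) $ (n - i)
        = ?y ^ Suc n * ?c n * (of_nat (n choose i) * arith_power_fps d a i * of_nat d ^ (n - i))"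
      if "i \<le> n" for i
    proof -
      have y: "?y ^ Suc i * ?y ^ (n - i) = ?y ^ Suc n"
        using that by (simp only: power_add[symmetric] add_Suc le_add_diff_inverse)
      have c: "?c i * ?c (n - i) = ?c n * of_nat (n choose i)"
        unfolding fps_const_mult fps_of_nat[symmetric]
        using that by (simp add: binomial_fact)
      have "?G $ i * fps_exp (of_nat d * ?y) $ (n - i)
          = (?y ^ Suc i * ?y ^ (n - i)) * (?c i * ?c (n - i))
            * (arith_power_fps d a i * of_nat d ^ (n - i))"
        unfolding P e power_mult_distrib by (simp only: mult_ac)
      also have "\<dots> = ?y ^ Suc n * ?c n * (of_nat (n choose i) * arith_power_fps d a i * of_nat d ^ (n - i))"
        unfolding y c by (simp only: mult.assoc)
      finally show ?thesis .
    qed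
    have "(?G * ?g) $ n = ?G $ n - fps_X * (\<Sum>i\<le>n. ?G $ i * fps_exp (of_nat d * ?y) $ (n - i))"
    proof -
      have "?G * ?g = ?G - fps_const fps_X * (?G * fps_exp (of_nat d * ?y))"
        by (simp only: right_diff_distrib mult_1_right mult.left_commute)
      then show ?thesis
        by (simp only: fps_sub_nth fps_mult_left_const_nth) (simp only: fps_mult_nth atLeast0AtMost)
    qed
    also have "\<dots> = ?y ^ Suc n * ?c n * (arith_power_fps d a n - fps_X * arith_power_fps d (a + d) n)"
    proof -
      have "(\<Sum>i\<le>n. ?G $ i * fps_exp (of_nat d * ?y) $ (n - i))
          = (\<Sum>i\<le>n. ?y ^ Suc n * ?c n
              * (of_nat (n choose i) * arith_power_fps d a i * of_nat d ^ (n - i)))"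
        by (intro sum.cong refl conv) simp
      also have "\<dots> = ?y ^ Suc n * ?c n * arith_power_fps d (a + d) n"
        by (simp only: arith_power_fps_add flip: sum_distrib_left)
      finally show ?thesis
        unfolding P by (simp only: right_diff_distrib mult_ac)
    qed
    \<comment> \<open>Of the n + 1 factors 1 - x, one is the prefactor in \<open>?f\<close> and the
      others belong to the exponential.\<close>
    also have "\<dots> = ?f $ n"
      unfolding arith_power_fps_shift fps_mult_left_const_nth e power_mult_distrib power_Suc of_nat_power
      by (simp only: mult_ac)
    finally show "(?G * ?g) $ n = ?f $ n" .
  qed
  moreover have "(?g $ 0) $ 0 \<noteq> 0"
    by simp
  ultimately show ?thesis
    by (rule fps_fps_eq_divideI[rotated])
qed

end
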